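(* Let $\mathbf P=(P,\le,{}',0,1)$ be a bounded saturated poset with a unary operation $'$. Then the generalized Sasaki operations $x\odot y$ and $x\to y$ are defined for all $x,y\in P$ if and only if $\mathbf P$ is orthogonal.
   Context: A bounded poset $(P,\le,0,1)$ has least element $0$ and greatest element $1$; $'$ is an arbitrary unary operation on $P$ (no further assumptions). For $x,y\in P$, $L(x,y)$ and $U(x,y)$ denote the sets of all common lower bounds, respectively common upper bounds, of $x$ and $y$; $\operatorname{Max}A$ and $\operatorname{Min}A$ denote the sets of maximal, respectively minimal, elements of $A\subseteq P$. For $x,y\in P$, $x\vee y$ and $x\wedge y$ denote the supremum and infimum in $P$; they are said to be defined if they exist. The poset is saturated if for all $x,y\in P$: every element of $L(x,y)$ lies below some element of $\operatorname{Max}L(x,y)$, and every element of $U(x,y)$ lies above some element of $\operatorname{Min}U(x,y)$. $(P,\le,{}')$ is orthogonal if for all $a,b\in P$: (1) if $a\le b$ then $a\vee b'$ is defined; (2) if $a'\le b$ then $a\wedge b$ is defined. The generalized Sasaki operations assign to $x,y\in P$ the subsets $x\odot y:=\operatorname{Min}U(x,y')\wedge y=\{m\wedge y\mid m\in\operatorname{Min}U(x,y')\}$ and $x\to y:=x'\vee\operatorname{Max}L(x,y)=\{x'\vee m\mid m\in\operatorname{Max}L(x,y)\}$. Here $x\odot y$ is defined if $m\wedge y$ exists for every $m\in\operatorname{Min}U(x,y')$, and $x\to y$ is defined if $x'\vee m$ exists for every $m\in\operatorname{Max}L(x,y)$. *)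

theory Defs
  imports "HOL-Library.Lub_Glb"
begin

text \<open>
  The poset is the whole type; \<open>L(x,y)\<close> and \<open>U(x,y)\<close> are \<open>lbs UNIV {x, y}\<close> and
  \<open>ubs UNIV {x, y}\<close>. The partial operations (supremum, infimum and the generalized Sasaki
  operations) return an option, with \<open>None\<close> for ``undefined''. The unary operation is the
  parameter \<open>c\<close>.
\<close>

definition maximals :: "'a::order set \<Rightarrow> 'a set"
  where "maximals A = {m \<in> A. \<not> (\<exists>a\<in>A. m < a)}"

definition minimals :: "'a::order set \<Rightarrow> 'a set"
  where "minimals A = {m \<in> A. \<not> (\<exists>a\<in>A. a < m)}"

definition pjoin :: "'a::order \<Rightarrow> 'a \<Rightarrow> 'a option"
  where "pjoin x y =
    (if \<exists>s. isLub UNIV {x, y} s then Some (THE s. isLub UNIV {x, y} s) else None)"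

definition pmeet :: "'a::order \<Rightarrow> 'a \<Rightarrow> 'a option"
  where "pmeet x y =
    (if \<exists>s. isGlb UNIV {x, y} s then Some (THE s. isGlb UNIV {x, y} s) else None)"

definition defined :: "'b option \<Rightarrow> bool"
  where "defined r \<longleftrightarrow> r \<noteq> None"

definition saturated :: "'a::order itself \<Rightarrow> bool"
  where "saturated _ \<longleftrightarrow> (\<forall>x y :: 'a.
    (\<forall>z \<in> lbs UNIV {x, y}. \<exists>m \<in> maximals (lbs UNIV {x, y}). z \<le> m) \<and>
    (\<forall>z \<in> ubs UNIV {x, y}. \<exists>m \<in> minimals (ubs UNIV {x, y}). m \<le> z))"

definition orthogonal_poset :: "('a::order \<Rightarrow> 'a) \<Rightarrow> bool"
  where "orthogonal_poset c \<longleftrightarrow> (\<forall>a b.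
    (a \<le> b \<longrightarrow> defined (pjoin a (c b))) \<and>
    (c a \<le> b \<longrightarrow> defined (pmeet a b)))"

definition sasaki_odot :: "('a::order \<Rightarrow> 'a) \<Rightarrow> 'a \<Rightarrow> 'a \<Rightarrow> 'a set option"
  where "sasaki_odot c x y =
    (if \<forall>m \<in> minimals (ubs UNIV {x, c y}). defined (pmeet m y)
     then Some {the (pmeet m y) | m. m \<in> minimals (ubs UNIV {x, c y})}
     else None)"

definition sasaki_imp :: "('a::order \<Rightarrow> 'a) \<Rightarrow> 'a \<Rightarrow> 'a \<Rightarrow> 'a set option"
  where "sasaki_imp c x y =
    (if \<forall>m \<in> maximals (lbs UNIV {x, y}). defined (pjoin (c x) m)
     then Some {the (pjoin (c x) m) | m. m \<in> maximals (lbs UNIV {x, y})}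
     else None)"

lemma pjoin_eq_Some_iff: "pjoin x y = Some s \<longleftrightarrow> isLub UNIV {x, y} s"
proof -
  have "(THE t. isLub UNIV {x, y} t) = s" if "isLub UNIV {x, y} s" for s
    using that by (meson isLub_isUb isLub_le_isUb order_antisym the_equality)
  then show ?thesis unfolding pjoin_def by auto
qed

lemma pmeet_eq_Some_iff: "pmeet x y = Some s \<longleftrightarrow> isGlb UNIV {x, y} s"
proof -
  have "(THE t. isGlb UNIV {x, y} t) = s" if "isGlb UNIV {x, y} s" for s
    using that by (meson isGlb_isLb isGlb_le_isLb order_antisym the_equality)
  then show ?thesis unfolding pmeet_def by auto
qed

end

theory Submission
  imports Defs
begin

text \<open>
  The definedness of the Sasaki operations and orthogonality concern the same joins and meets,
  because every comparable pair arises from a suitable choice of arguments. An element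
  \<open>m\<close> of \<open>Max L(x,y)\<close> lies below \<open>x\<close>, so the join of \<open>x'\<close> and \<open>m\<close> is one that orthogonality
  provides; an element \<open>m\<close> of \<open>Min U(x,y')\<close> lies above \<open>y'\<close>, so likewise for the meet of
  \<open>m\<close> and \<open>y\<close>. Conversely, if \<open>a \<le> b\<close> then \<open>Max L(b,a) = {a}\<close>, so \<open>b \<rightarrow> a\<close> can be defined only if
  \<open>b' \<or> a\<close> is; if \<open>a' \<le> b\<close> then \<open>Min U(b,a') = {b}\<close>, so \<open>b \<odot> a\<close> can be defined only if
  \<open>b \<and> a\<close> is.
\<close>

lemma pjoin_commute: "pjoin x y = pjoin y x"
  unfolding pjoin_def by (simp add: insert_commute)

lemma pmeet_commute: "pmeet x y = pmeet y x"
  unfolding pmeet_def by (simp add: insert_commute)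

lemma mem_lbs_pair_iff: "z \<in> lbs UNIV {x, y} \<longleftrightarrow> z \<le> x \<and> z \<le> y"
  by (auto simp: lbs_def isLb_def setge_def)

lemma mem_ubs_pair_iff: "z \<in> ubs UNIV {x, y} \<longleftrightarrow> x \<le> z \<and> y \<le> z"
  by (auto simp: ubs_def isUb_def setle_def)

lemma maximals_lbs_of_le:
  assumes "a \<le> b"
  shows "maximals (lbs UNIV {b, a}) = {a}"
  using assms by (auto simp: maximals_def mem_lbs_pair_iff order.strict_iff_order)

lemma minimals_ubs_of_le:
  assumes "a \<le> b"
  shows "minimals (ubs UNIV {b, a}) = {b}"
  using assms by (auto simp: minimals_def mem_ubs_pair_iff order.strict_iff_order)

lemma defined_sasaki_imp_iff:
  "defined (sasaki_imp c x y) \<longleftrightarrow> (\<forall>m \<in> maximals (lbs UNIV {x, y}). defined (pjoin (c x) m))"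
  by (simp add: sasaki_imp_def defined_def)

lemma defined_sasaki_odot_iff:
  "defined (sasaki_odot c x y) \<longleftrightarrow> (\<forall>m \<in> minimals (ubs UNIV {x, c y}). defined (pmeet m y))"
  by (simp add: sasaki_odot_def defined_def)

text \<open>
  Each operation accounts for exactly one of the two clauses of orthogonality: \<open>\<rightarrow>\<close> forms only joins
  \<open>x' \<or> m\<close> with \<open>m \<le> x\<close>, and among them every such join, since \<open>m\<close> is the only element of
  \<open>Max L(x,m)\<close>.
\<close>

lemma sasaki_imp_total_iff:
  "(\<forall>x y. defined (sasaki_imp c x y)) \<longleftrightarrow> (\<forall>a b. a \<le> b \<longrightarrow> defined (pjoin a (c b)))"
proof (intro iffI allI impI)
  fix a b :: 'a
  assume total: "\<forall>x y. defined (sasaki_imp c x y)" and "a \<le> b"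
  from total have "defined (sasaki_imp c b a)" by blast
  then show "defined (pjoin a (c b))"
    using \<open>a \<le> b\<close> by (simp add: defined_sasaki_imp_iff maximals_lbs_of_le pjoin_commute)
next
  fix x y :: 'a
  assume "\<forall>a b. a \<le> b \<longrightarrow> defined (pjoin a (c b))"
  then show "defined (sasaki_imp c x y)"
    by (simp add: defined_sasaki_imp_iff maximals_def mem_lbs_pair_iff pjoin_commute)
qed

text \<open>
  In the same way \<open>\<odot>\<close> forms exactly the meets \<open>m \<and> y\<close> with \<open>y' \<le> m\<close>, since \<open>m\<close> is the only
  element of \<open>Min U(m,y')\<close>.
\<close>

lemma sasaki_odot_total_iff:
  "(\<forall>x y. defined (sasaki_odot c x y)) \<longleftrightarrow> (\<forall>a b. c a \<le> b \<longrightarrow> defined (pmeet a b))"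
proof (intro iffI allI impI)
  fix a b :: 'a
  assume total: "\<forall>x y. defined (sasaki_odot c x y)" and "c a \<le> b"
  from total have "defined (sasaki_odot c b a)" by blast
  then show "defined (pmeet a b)"
    using \<open>c a \<le> b\<close> by (simp add: defined_sasaki_odot_iff minimals_ubs_of_le pmeet_commute)
next
  fix x y :: 'a
  assume "\<forall>a b. c a \<le> b \<longrightarrow> defined (pmeet a b)"
  then show "defined (sasaki_odot c x y)"
    by (auto simp: defined_sasaki_odot_iff minimals_def mem_ubs_pair_iff
        intro: ssubst[OF pmeet_commute, of defined])
qed

theorem proposition3p2:
  fixes c :: "'a::{order_bot,order_top} \<Rightarrow> 'a"
  assumes "saturated TYPE('a)"
  shows "(\<forall>x y. defined (sasaki_odot c x y) \<and> defined (sasaki_imp c x y))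
    \<longleftrightarrow> orthogonal_poset c"
  using sasaki_imp_total_iff[of c] sasaki_odot_total_iff[of c]
  unfolding orthogonal_poset_def by blast

end
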